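(* Let $n\ge 0$ be an integer and let $q,a,b$ be nonzero complex parameters such that no denominator occurring below vanishes. Then $$ {}_4\phi_3\left[\begin{array}{c} q^{-2n},\, aq^2,\, bq^2,\, q^{1-2n}/ab \\ q^{2-2n}/a,\, q^{2-2n}/b,\, abq^3\end{array};q^2,\,q^2\right] =\frac{q^{-n}\,(aq,bq,-q;q)_n\,(abq^2;q^2)_{n}}{(1-abq^{2n+1})\,(abq^2;q)_{n-1}\,(a,b;q^2)_n}. $$
   Context: For an integer $n\ge 0$, $(x;q)_n=\prod_{i=0}^{n-1}(1-xq^i)$ (so $(x;q)_0=1$), and $(x_1,\ldots,x_m;q)_n=\prod_{i=1}^m (x_i;q)_n$; $(x;q^2)_n$ is the same with $q$ replaced by $q^2$. For index $-1$ (occurring only when $n=0$) the usual convention is $(x;q)_{-1}=1/(1-xq^{-1})$. The basic hypergeometric series is $${}_4\phi_3\left[\begin{array}{c} a_1,a_2,a_3,a_4\\ b_1,b_2,b_3\end{array};q,z\right]=\sum_{k\ge 0}\frac{(a_1,a_2,a_3,a_4;q)_k\,z^k}{(q,b_1,b_2,b_3;q)_k}.$$ In the claim the base is $q^2$ (replace $q$ by $q^2$ in the definition) and $a_1=q^{-2n}$, so the series terminates: it denotes the finite sum over $0\le k\le n$. Here $q^{c}/ab$ means $q^{c}/(ab)$. The identity is to be understood as an identity of rational functions in $a,b,q$, i.e. valid whenever no denominator vanishes. *)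

theory Defs
  imports Complex_Main
begin

text \<open>
  The $q$-Pochhammer symbol $(x;q)_m$ with integer index. For negative index it is given by
  $(x;q)_{-m} = 1 / \prod_{i=1}^{m} (1 - x q^{-i})$, of which only the value at $-1$ is needed.
\<close>

definition qpoch :: "complex \<Rightarrow> complex \<Rightarrow> int \<Rightarrow> complex" where
  "qpoch x q m =
     (if 0 \<le> m then \<Prod>i<nat m. 1 - x * q ^ i
      else 1 / (\<Prod>i=1..nat (- m). 1 - x / q ^ i))"

definition qpochs :: "complex list \<Rightarrow> complex \<Rightarrow> int \<Rightarrow> complex" where
  "qpochs xs q m = (\<Prod>x\<leftarrow>xs. qpoch x q m)"

definition phi43 ::
  "complex \<Rightarrow> complex \<Rightarrow> complex \<Rightarrow> complex \<Rightarrow> complex \<Rightarrow> complex \<Rightarrow> complex \<Rightarrow> complex \<Rightarrow> complex \<Rightarrow> complex" where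
  "phi43 a1 a2 a3 a4 b1 b2 b3 q z =
     (\<Sum>k. qpochs [a1, a2, a3, a4] q (int k) * z ^ k / qpochs [q, b1, b2, b3] q (int k))"

lemma qpoch_minus_one: "qpoch x q (- 1) = 1 / (1 - x * q powi (- 1))"
  by (simp add: qpoch_def divide_inverse power_int_minus)

lemma qpoch_terminates:
  assumes "q \<noteq> 0" and "n < k"
  shows "qpoch (q powi (- int n)) q (int k) = 0"
proof -
  have "1 - q powi (- int n) * q ^ n = 0"
    using assms(1) by (simp add: power_int_minus)
  with assms(2) show ?thesis
    by (auto simp: qpoch_def intro!: prod_zero bexI[of _ n])
qed

text \<open>
  The terms with $k > n$ vanish because of their numerators. Their denominators may vanish
  as well, which is harmless since division by zero yields zero.
\<close>

lemma phi43_terminating: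
  assumes "q \<noteq> 0"
  shows "phi43 (q powi (- int n)) a2 a3 a4 b1 b2 b3 q z =
    (\<Sum>k\<le>n. qpochs [q powi (- int n), a2, a3, a4] q (int k) * z ^ k
             / qpochs [q, b1, b2, b3] q (int k))"
  unfolding phi43_def
  by (rule suminf_finite) (auto simp: qpochs_def qpoch_terminates[OF assms])

end

theory Submission
  imports Defs
begin

text \<open>
  Write $p = q^2$, $c = abq$, $x = q^k$, $y = q^{n-k}$ and
  $C_k = (a;p)_k (b;p)_k / ((p;p)_k (cp;p)_k)$. Reversing the four shifted factorials whose
  argument involves $p^{-n}$ (lemma \<open>qfac_reverse\<close>) turns the series into an elementary
  multiple of the convolution
  $$V_n = \sum_{k \le n} C_k C_{n-k} \, y (1 - a x^2)(1 - b x^2)(1 - c y^2).$$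
  The convolution does not change when the summand is averaged with its image under
  $k \mapsto n-k$. This symmetrisation is the key: the symmetrised summand admits a first-order
  Wilf--Zeilberger certificate, although the original one does not. Telescoping gives
  $$(1 - c R^2)(1 - abR)(1 - R) V_{n+1} = (1 - aR)(1 - bR)(1 - abR^2) V_n, \qquad R = q^{n+1},$$
  (lemma \<open>wsum_rec\<close>), whose solution is the asserted product. The rational-function content
  of the telescoping is the polynomial identity \<open>cert_step\<close> in independent variables
  $a, b, q, x, y$.

  The hypotheses do allow $abq = 1$ when $n \ge 1$. Hence $C_k$ is built from $(cp;p)_k$
  instead of $(c;p)_k$, and the recurrence is iterated from $n = 1$.
\<close>

section \<open>Shifted factorials with natural index\<close>

definition qfac :: "complex \<Rightarrow> complex \<Rightarrow> nat \<Rightarrow> complex" where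
  "qfac x q n = (\<Prod>i<n. 1 - x * q ^ i)"

lemma qpoch_int: "qpoch x q (int n) = qfac x q n"
  by (simp add: qpoch_def qfac_def)

lemma qfac_0 [simp]: "qfac x q 0 = 1"
  by (simp add: qfac_def)

lemma qfac_Suc: "qfac x q (Suc n) = qfac x q n * (1 - x * q ^ n)"
  by (simp add: qfac_def)

lemma qfac_shift: "(1 - x) * qfac (x * q) q n = qfac x q n * (1 - x * q ^ n)"
  by (induction n) (simp_all add: qfac_Suc mult_ac)

lemma qfac_nonzero_mono:
  assumes "qfac x q n \<noteq> 0" "k \<le> n"
  shows "qfac x q k \<noteq> 0"
  using assms by (auto simp: qfac_def)

lemma qfac_square: "qfac (q\<^sup>2) (q\<^sup>2) n = qfac q q n * qfac (- q) q n"
proof (induction n)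
  case (Suc n)
  have "1 - q\<^sup>2 * (q\<^sup>2) ^ n = (1 - q * q ^ n) * (1 - (- q) * q ^ n)"
    by (simp add: power2_eq_square power_mult_distrib algebra_simps)
  then show ?case
    by (simp only: qfac_Suc Suc.IH mult_ac)
qed simp

text \<open>
  The factors $1 - z p^i$ with $n - k \le i < n$: the quotient $(z;p)_n / (z;p)_{n-k}$ in a form
  that stays meaningful when $(z;p)_{n-k}$ vanishes.
\<close>

definition qtop :: "complex \<Rightarrow> complex \<Rightarrow> nat \<Rightarrow> nat \<Rightarrow> complex" where
  "qtop z p n k = (\<Prod>i<k. 1 - z * p ^ (n - Suc i))"

lemma qtop_Suc: "qtop z p n (Suc k) = qtop z p n k * (1 - z * p ^ (n - Suc k))"
  by (simp add: qtop_def)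

lemma qtop_mult:
  assumes "k \<le> n"
  shows "qtop z p n k * qfac z p (n - k) = qfac z p n"
  using assms
proof (induction k)
  case (Suc k)
  then have "n - k = Suc (n - Suc k)" by simp
  with Suc show ?case by (simp add: qtop_Suc qfac_Suc mult_ac)
qed (simp add: qtop_def)

lemma qtop_shift:
  assumes "k \<le> n"
  shows "qtop z p n k * (1 - z * p ^ n) = (1 - z * p ^ (n - k)) * qtop (z * p) p n k"
  using assms
proof (induction k)
  case (Suc k)
  then have *: "p ^ (n - k) = p * p ^ (n - Suc k)"
    by (metis Suc_diff_Suc Suc_le_eq power_Suc)
  have "qtop z p n (Suc k) * (1 - z * p ^ n)
      = (1 - z * p ^ (n - Suc k)) * (qtop z p n k * (1 - z * p ^ n))"
    by (simp add: qtop_Suc mult_ac)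
  also have "\<dots> = (1 - z * p ^ (n - Suc k)) * ((1 - z * p ^ (n - k)) * qtop (z * p) p n k)"
    using Suc by simp
  finally show ?case
    by (simp add: qtop_Suc * mult_ac)
qed (simp add: qtop_def)

text \<open>
  Each factor is turned over by $1 - 1/w = -(1 - w)/w$. Only the power $z^k$ depends on $z$; the
  factor $E_k$ is common to all four reversed factorials of the series and cancels there.
\<close>

lemma qfac_reverse:
  fixes z p :: complex
  assumes "z \<noteq> 0" "p \<noteq> 0" "k \<le> n"
  shows "qfac (p powi (1 - int n) / z) p k * z ^ k
    = (\<Prod>i<k. - (p powi (int i + 1 - int n))) * qtop z p n k"
proof -
  have "(1 - p powi (1 - int n) / z * p ^ i) * z
      = - (p powi (int i + 1 - int n)) * (1 - z * p ^ (n - Suc i))" if "i < k" for i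
  proof -
    have "int i + 1 - int n = - int (n - Suc i)"
      using that assms(3) by (simp add: of_nat_diff)
    then have 1: "p powi (int i + 1 - int n) * p ^ (n - Suc i) = 1"
      using assms(2) by (simp only: power_int_minus power_int_of_nat) simp
    have 2: "p powi (1 - int n) * p ^ i = p powi (int i + 1 - int n)"
      using assms(2) by (simp add: power_int_add power_int_diff)
    have "(1 - p powi (1 - int n) / z * p ^ i) * z = z - p powi (1 - int n) * p ^ i"
      using assms(1) by (simp add: field_simps)
    also have "\<dots> = z * (p powi (int i + 1 - int n) * p ^ (n - Suc i)) - p powi (int i + 1 - int n)"
      unfolding 1 2 by simp
    finally show ?thesis by (simp add: algebra_simps)
  qed
  then have "(\<Prod>i<k. (1 - p powi (1 - int n) / z * p ^ i) * z)
      = (\<Prod>i<k. - (p powi (int i + 1 - int n)) * (1 - z * p ^ (n - Suc i)))"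
    by (intro prod.cong) auto
  then show ?thesis
    unfolding prod.distrib by (simp add: qfac_def qtop_def)
qed

section \<open>The certificate\<close>

text \<open>
  The factor of the summand of $V_n$ by which it fails to be symmetric under $k \<mapsto> n-k$.
\<close>

definition wt :: "complex \<Rightarrow> complex \<Rightarrow> complex \<Rightarrow> complex \<Rightarrow> complex \<Rightarrow> complex" where
  "wt a b q x y = y * (1 - a * x\<^sup>2) * (1 - b * x\<^sup>2) * (1 - a * b * q * y\<^sup>2)"

text \<open>
  The polynomial part of the $q$-Gosper certificate for the symmetrised summand, with $v = qy$ and
  $R = xv$. As a Laurent polynomial in $x$ for fixed $R$ it can only involve $x, x^{-1}, x^{-3},
  x^{-5}$, for degree reasons, and comparing coefficients in \<open>cert_step\<close> determines it.
\<close>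

definition cert :: "complex \<Rightarrow> complex \<Rightarrow> complex \<Rightarrow> complex \<Rightarrow> complex \<Rightarrow> complex \<Rightarrow> complex" where
  "cert a b q R x v =
     v * (a * b * (1 - R) * (x\<^sup>2 - a * b * q * R * v ^ 4)
       - (1 - (a + b) * R + a * b * q * R * (1 - R) + a * b * (a + b) * R\<^sup>2 - a\<^sup>2 * b\<^sup>2 * R ^ 4)
       + a * b * v\<^sup>2 * (q - (a + b) * q * R\<^sup>2 + a * b * R\<^sup>2 * (1 - R)
           + a * b * (a + b) * q * R ^ 3 - a\<^sup>2 * b\<^sup>2 * q * R ^ 4))"

lemma cert_step:
  fixes a b q x y :: complex
  assumes "R = q * x * y"
  shows "(1 - a * b * q * R\<^sup>2) * (1 - a * b * R) * (1 - R)
      * (1 - a * y\<^sup>2) * (1 - b * y\<^sup>2) * (wt a b q x (q * y) + wt a b q (q * y) x)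
    - (1 - a * R) * (1 - b * R) * (1 - a * b * R\<^sup>2)
      * (1 - q\<^sup>2 * y\<^sup>2) * (1 - a * b * q ^ 3 * y\<^sup>2) * (wt a b q x y + wt a b q y x)
    = (1 - a * x\<^sup>2) * (1 - b * x\<^sup>2) * (1 - q\<^sup>2 * y\<^sup>2) * (1 - a * b * q ^ 3 * y\<^sup>2)
        * cert a b q R (q * x) y
    - (1 - x\<^sup>2) * (1 - a * b * q * x\<^sup>2) * (1 - a * y\<^sup>2) * (1 - b * y\<^sup>2) * cert a b q R x (q * y)"
  unfolding assms wt_def cert_def by algebra

text \<open>
  The endpoint $x = R$, $qy = 1$, which is not covered by the step: $V_{n+1}$ has one more term
  than $V_n$, and it must be what the telescoping leaves over.
\<close>

lemma cert_boundary:
  fixes a b q R :: complex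
  shows "(1 - a * b * R) * (wt a b q R 1 + wt a b q 1 R) = - (1 + R) * cert a b q R R 1"
  unfolding wt_def cert_def power_one mult_1_left mult_1_right by algebra

section \<open>The convolution and its recurrence\<close>

definition wcoeff :: "complex \<Rightarrow> complex \<Rightarrow> complex \<Rightarrow> nat \<Rightarrow> complex" where
  "wcoeff a b q k =
     qfac a (q\<^sup>2) k * qfac b (q\<^sup>2) k / (qfac (q\<^sup>2) (q\<^sup>2) k * qfac (a * b * q ^ 3) (q\<^sup>2) k)"

definition wsum :: "complex \<Rightarrow> complex \<Rightarrow> complex \<Rightarrow> nat \<Rightarrow> complex" where
  "wsum a b q n = (\<Sum>k\<le>n. wcoeff a b q k * wcoeff a b q (n - k) * wt a b q (q ^ k) (q ^ (n - k)))"

lemma wcoeff_0 [simp]: "wcoeff a b q 0 = 1"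
  by (simp add: wcoeff_def)

lemma wcoeff_Suc:
  assumes "qfac (q\<^sup>2) (q\<^sup>2) (Suc k) \<noteq> 0" "qfac (a * b * q ^ 3) (q\<^sup>2) (Suc k) \<noteq> 0"
  shows "wcoeff a b q (Suc k) * ((1 - q\<^sup>2 * (q ^ k)\<^sup>2) * (1 - a * b * q ^ 3 * (q ^ k)\<^sup>2))
    = wcoeff a b q k * ((1 - a * (q ^ k)\<^sup>2) * (1 - b * (q ^ k)\<^sup>2))"
proof -
  have e: "(q\<^sup>2) ^ k = (q ^ k)\<^sup>2"
    by (simp flip: power_mult add: mult.commute)
  show ?thesis
    using assms by (simp add: wcoeff_def qfac_Suc e divide_simps)
qed

lemma wsum_symmetric:
  "(\<Sum>k\<le>n. wcoeff a b q k * wcoeff a b q (n - k)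
      * (wt a b q (q ^ k) (q ^ (n - k)) + wt a b q (q ^ (n - k)) (q ^ k))) = 2 * wsum a b q n"
proof -
  have "(\<Sum>k\<le>n. wcoeff a b q k * wcoeff a b q (n - k) * wt a b q (q ^ (n - k)) (q ^ k)) = wsum a b q n"
    unfolding wsum_def
    by (rule sum.reindex_bij_witness[of _ "\<lambda>k. n - k" "\<lambda>k. n - k"]) (auto simp: mult_ac)
  then show ?thesis
    by (simp add: distrib_left sum.distrib wsum_def)
qed

text \<open>
  The factor that turns $C_{n-k}$ into $C_{n+1-k}$ is $(1 - ay^2)(1 - by^2)$ divided by
  $(1 - py^2)(1 - cpy^2)$, and the same rule takes $C_k$ to $C_{k+1}$. After multiplication by
  the denominator, each telescoping step is therefore \<open>cert_step\<close> times $C_k C_{n-k}$.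
\<close>

lemma wsum_rec:
  fixes a b q :: complex
  defines "R \<equiv> \<lambda>n. q ^ Suc n"
  assumes nzp: "qfac (q\<^sup>2) (q\<^sup>2) (Suc n) \<noteq> 0" and nzc: "qfac (a * b * q ^ 3) (q\<^sup>2) (Suc n) \<noteq> 0"
  shows "(1 - a * b * q * (R n)\<^sup>2) * (1 - a * b * R n) * (1 - R n) * wsum a b q (Suc n)
    = (1 - a * R n) * (1 - b * R n) * (1 - a * b * (R n)\<^sup>2) * wsum a b q n"
proof -
  define r where "r = R n"
  define C where "C = wcoeff a b q"
  define L where "L = (1 - a * b * q * r\<^sup>2) * (1 - a * b * r) * (1 - r)"
  define K where "K = (1 - a * r) * (1 - b * r) * (1 - a * b * r\<^sup>2)"
  define H where "H = (\<lambda>x y. wt a b q x y + wt a b q y x)"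
  \<comment> \<open>The quantity that telescopes; it vanishes at $k = 0$ because of its first factor.\<close>
  define G where "G = (\<lambda>k. (1 - (q ^ k)\<^sup>2) * (1 - a * b * q * (q ^ k)\<^sup>2)
    * cert a b q r (q ^ k) (q ^ (Suc n - k)) * (C k * C (Suc n - k)))"
  have CS: "C (Suc k) * ((1 - q\<^sup>2 * (q ^ k)\<^sup>2) * (1 - a * b * q ^ 3 * (q ^ k)\<^sup>2))
      = C k * ((1 - a * (q ^ k)\<^sup>2) * (1 - b * (q ^ k)\<^sup>2))" if "k \<le> n" for k
    unfolding C_def using that nzp nzc 
    by (intro wcoeff_Suc) (auto dest: qfac_nonzero_mono[of _ _ _ "Suc k"])
  have nz: "(1 - q\<^sup>2 * (q ^ k)\<^sup>2) * (1 - a * b * q ^ 3 * (q ^ k)\<^sup>2) \<noteq> 0" if "k \<le> n" for k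
  proof -
    have "qfac (q\<^sup>2) (q\<^sup>2) (Suc k) \<noteq> 0" "qfac (a * b * q ^ 3) (q\<^sup>2) (Suc k) \<noteq> 0"
      using that nzp nzc by (auto dest: qfac_nonzero_mono[of _ _ _ "Suc k"])
    then show ?thesis
      by (auto simp: qfac_Suc simp flip: power_mult) (simp_all add: mult.commute)
  qed
  have step: "L * (C k * C (Suc n - k) * H (q ^ k) (q ^ (Suc n - k)))
      - K * (C k * C (n - k) * H (q ^ k) (q ^ (n - k))) = G (Suc k) - G k" if "k \<le> n" for k
  proof -
    define x y where "x = q ^ k" and "y = q ^ (n - k)"
    define d where "d = (1 - q\<^sup>2 * y\<^sup>2) * (1 - a * b * q ^ 3 * y\<^sup>2)"
    have S: "Suc n - k = Suc (n - k)" and qy: "q ^ (Suc n - k) = q * y"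
      using that by (simp_all add: y_def Suc_diff_le)
    have rxy: "r = q * x * y"
      using that by (simp add: r_def R_def x_def y_def flip: power_add)
    have d: "d \<noteq> 0" and Cy: "C (Suc n - k) * d = C (n - k) * ((1 - a * y\<^sup>2) * (1 - b * y\<^sup>2))"
      unfolding S d_def y_def using nz[of "n - k"] CS[of "n - k"] by simp_all
    have Cx: "C (Suc k) * ((1 - q\<^sup>2 * x\<^sup>2) * (1 - a * b * q ^ 3 * x\<^sup>2))
        = C k * ((1 - a * x\<^sup>2) * (1 - b * x\<^sup>2))"
      unfolding x_def by (rule CS[OF that])
    have "G (Suc k) = C (Suc k) * ((1 - q\<^sup>2 * x\<^sup>2) * (1 - a * b * q ^ 3 * x\<^sup>2))
        * (cert a b q r (q * x) y * C (n - k))"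
      by (simp add: G_def x_def y_def power_mult_distrib power2_eq_square power3_eq_cube mult_ac)
    then have G1: "G (Suc k) = C k * C (n - k) * ((1 - a * x\<^sup>2) * (1 - b * x\<^sup>2) * cert a b q r (q * x) y)"
      unfolding Cx by (simp add: mult_ac)
    have "d * (L * (C k * C (Suc n - k) * H x (q * y)) - K * (C k * C (n - k) * H x y))
        = C k * (C (Suc n - k) * d) * (L * H x (q * y)) - C k * C (n - k) * (K * d * H x y)"
      by (simp add: algebra_simps)
    also have "\<dots> = C k * C (n - k)
        * (L * (1 - a * y\<^sup>2) * (1 - b * y\<^sup>2) * H x (q * y)
           - K * (1 - q\<^sup>2 * y\<^sup>2) * (1 - a * b * q ^ 3 * y\<^sup>2) * H x y)"
      unfolding Cy unfolding d_def by algebra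
    also have "\<dots> = C k * C (n - k)
        * ((1 - a * x\<^sup>2) * (1 - b * x\<^sup>2) * (1 - q\<^sup>2 * y\<^sup>2) * (1 - a * b * q ^ 3 * y\<^sup>2)
             * cert a b q r (q * x) y
           - (1 - x\<^sup>2) * (1 - a * b * q * x\<^sup>2) * (1 - a * y\<^sup>2) * (1 - b * y\<^sup>2) * cert a b q r x (q * y))"
      unfolding L_def K_def H_def cert_step[OF rxy] ..
    also have "\<dots> = d * G (Suc k) - C k * (C (Suc n - k) * d)
        * ((1 - x\<^sup>2) * (1 - a * b * q * x\<^sup>2) * cert a b q r x (q * y))"
      unfolding Cy G1 unfolding d_def by algebra
    also have "\<dots> = d * (G (Suc k) - G k)"
      unfolding G_def qy x_def[symmetric] by (simp add: algebra_simps)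
    finally show ?thesis
      using d by (simp add: qy flip: x_def y_def)
  qed
  have sum: "(\<Sum>k\<le>m. C k * C (m - k) * H (q ^ k) (q ^ (m - k))) = 2 * wsum a b q m" for m
    unfolding C_def H_def by (rule wsum_symmetric)
  have "L * (\<Sum>k\<le>n. C k * C (Suc n - k) * H (q ^ k) (q ^ (Suc n - k)))
      - K * (\<Sum>k\<le>n. C k * C (n - k) * H (q ^ k) (q ^ (n - k))) = (\<Sum>k\<le>n. G (Suc k) - G k)"
    by (simp add: step sum_distrib_left flip: sum_subtractf)
  also have "\<dots> = G (Suc n) - G 0"
    unfolding lessThan_Suc_atMost[symmetric] by (rule sum_lessThan_telescope)
  also have "G 0 = 0"
    by (simp add: G_def)
  also have "G (Suc n) - 0 = - L * (C (Suc n) * H r 1)"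
  proof -
    have "L * H r 1 = (1 - a * b * q * r\<^sup>2) * (1 - r)
        * ((1 - a * b * r) * (wt a b q r 1 + wt a b q 1 r))"
      by (simp add: L_def H_def mult_ac)
    also have "\<dots> = - ((1 - r\<^sup>2) * (1 - a * b * q * r\<^sup>2) * cert a b q r r 1)"
      unfolding cert_boundary by (simp add: power2_eq_square algebra_simps)
    finally have *: "L * H r 1 = - ((1 - r\<^sup>2) * (1 - a * b * q * r\<^sup>2) * cert a b q r r 1)" .
    have "G (Suc n) = (1 - r\<^sup>2) * (1 - a * b * q * r\<^sup>2) * cert a b q r r 1 * C (Suc n)"
      by (simp add: G_def C_def r_def R_def)
    also have "\<dots> = - (L * H r 1) * C (Suc n)"
      unfolding * by simp
    finally show ?thesis by (simp add: mult_ac)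
  qed
  finally have "L * ((\<Sum>k\<le>n. C k * C (Suc n - k) * H (q ^ k) (q ^ (Suc n - k))) + C (Suc n) * H r 1)
      = K * (\<Sum>k\<le>n. C k * C (n - k) * H (q ^ k) (q ^ (n - k)))"
    by (simp add: algebra_simps)
  also have "(\<Sum>k\<le>n. C k * C (Suc n - k) * H (q ^ k) (q ^ (Suc n - k))) + C (Suc n) * H r 1
      = 2 * wsum a b q (Suc n)"
    unfolding sum[symmetric] by (simp add: C_def r_def R_def)
  finally show ?thesis
    unfolding sum by (simp add: L_def K_def r_def mult.assoc)
qed

lemma wsum_closed:
  fixes a b q :: complex
  assumes "qfac (q\<^sup>2) (q\<^sup>2) (Suc m) \<noteq> 0" "qfac (a * b * q ^ 3) (q\<^sup>2) (Suc m) \<noteq> 0"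
    and "qfac (a * b * q\<^sup>2) q m \<noteq> 0"
  shows "wsum a b q (Suc m) * (qfac (a * b * q ^ 3) (q\<^sup>2) (Suc m) * qfac (a * b * q\<^sup>2) q m * qfac q q (Suc m))
    = (1 - a) * (1 - b) * qfac (a * q) q (Suc m) * qfac (b * q) q (Suc m)
      * qfac (a * b * q\<^sup>2) (q\<^sup>2) (Suc m)"
  using assms
proof (induction m)
  case 0
  then have nz: "1 - q\<^sup>2 \<noteq> 0" "1 - a * b * q ^ 3 \<noteq> 0"
    by (simp_all add: qfac_Suc)
  define C where "C = wcoeff a b q 1"
  have C: "C * ((1 - q\<^sup>2) * (1 - a * b * q ^ 3)) = (1 - a) * (1 - b)"
    using nz by (simp add: C_def wcoeff_def qfac_def)
  have "(1 + q) * (wsum a b q (Suc 0) * ((1 - a * b * q ^ 3) * (1 - q)))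
      = (wt a b q 1 q + wt a b q q 1) * (C * ((1 - q\<^sup>2) * (1 - a * b * q ^ 3)))"
    by (simp add: wsum_def C_def power2_eq_square algebra_simps)
  also have "wt a b q 1 q + wt a b q q 1 = (1 + q) * ((1 - a * q) * (1 - b * q) * (1 - a * b * q\<^sup>2))"
    unfolding wt_def power_one mult_1_left mult_1_right by algebra
  finally have "(1 + q) * (wsum a b q (Suc 0) * ((1 - a * b * q ^ 3) * (1 - q)))
      = (1 + q) * ((1 - a) * (1 - b) * (1 - a * q) * (1 - b * q) * (1 - a * b * q\<^sup>2))"
    unfolding C by (simp only: mult_ac)
  moreover have "1 + q \<noteq> 0"
    using nz(1) by (metis add_eq_0_iff diff_self power2_minus power_one)
  ultimately show ?case
    by (simp add: qfac_Suc)
next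
  case (Suc m)
  define r where "r = q ^ Suc (Suc m)"
  have nz: "qfac (q\<^sup>2) (q\<^sup>2) (Suc m) \<noteq> 0" "qfac (a * b * q ^ 3) (q\<^sup>2) (Suc m) \<noteq> 0"
    "qfac (a * b * q\<^sup>2) q m \<noteq> 0"
    using Suc.prems by (auto simp: qfac_Suc)
  have e: "a * b * q ^ 3 * (q\<^sup>2) ^ Suc m = a * b * q * r\<^sup>2"
      "a * b * q\<^sup>2 * q ^ m = a * b * r" "q * q ^ Suc m = r" "a * q * q ^ Suc m = a * r"
      "b * q * q ^ Suc m = b * r" "a * b * q\<^sup>2 * (q\<^sup>2) ^ Suc m = a * b * r\<^sup>2"
    by (simp_all add: r_def power2_eq_square power3_eq_cube power_mult_distrib)
  have rec: "(1 - a * b * q * r\<^sup>2) * (1 - a * b * r) * (1 - r) * wsum a b q (Suc (Suc m))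
    = (1 - a * r) * (1 - b * r) * (1 - a * b * r\<^sup>2) * wsum a b q (Suc m)"
    unfolding r_def by (rule wsum_rec) (use Suc.prems in auto)
  have s: "qfac (a * b * q ^ 3) (q\<^sup>2) (Suc (Suc m)) = qfac (a * b * q ^ 3) (q\<^sup>2) (Suc m) * (1 - a * b * q * r\<^sup>2)"
    "qfac (a * b * q\<^sup>2) q (Suc m) = qfac (a * b * q\<^sup>2) q m * (1 - a * b * r)"
    "qfac q q (Suc (Suc m)) = qfac q q (Suc m) * (1 - r)"
    "qfac (a * q) q (Suc (Suc m)) = qfac (a * q) q (Suc m) * (1 - a * r)"
    "qfac (b * q) q (Suc (Suc m)) = qfac (b * q) q (Suc m) * (1 - b * r)"
    "qfac (a * b * q\<^sup>2) (q\<^sup>2) (Suc (Suc m)) = qfac (a * b * q\<^sup>2) (q\<^sup>2) (Suc m) * (1 - a * b * r\<^sup>2)"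
    by (simp_all only: qfac_Suc[of _ _ "Suc m"] qfac_Suc[of _ _ m] e)
  have "wsum a b q (Suc (Suc m)) * (qfac (a * b * q ^ 3) (q\<^sup>2) (Suc (Suc m))
        * qfac (a * b * q\<^sup>2) q (Suc m) * qfac q q (Suc (Suc m)))
    = ((1 - a * b * q * r\<^sup>2) * (1 - a * b * r) * (1 - r) * wsum a b q (Suc (Suc m)))
      * (qfac (a * b * q ^ 3) (q\<^sup>2) (Suc m) * qfac (a * b * q\<^sup>2) q m * qfac q q (Suc m))"
    unfolding s by (simp only: mult_ac)
  also have "\<dots> = (1 - a * r) * (1 - b * r) * (1 - a * b * r\<^sup>2)
      * (wsum a b q (Suc m)
         * (qfac (a * b * q ^ 3) (q\<^sup>2) (Suc m) * qfac (a * b * q\<^sup>2) q m * qfac q q (Suc m)))"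
    unfolding rec by (simp only: mult_ac)
  also have "\<dots> = (1 - a) * (1 - b) * qfac (a * q) q (Suc (Suc m)) * qfac (b * q) q (Suc (Suc m))
      * qfac (a * b * q\<^sup>2) (q\<^sup>2) (Suc (Suc m))"
    unfolding Suc.IH[OF nz] s by (simp only: mult_ac)
  finally show ?case .
qed

section \<open>From the series to the convolution\<close>

text \<open>
  After reversal, the powers of $z = p, a, b, c$ combine with $p^k$ to
  $(ab/c)^k = q^{-k} = q^{-n} y$, which is where the factor $y$ of \<open>wt\<close> comes from. The
  remaining factors arise from $(ap;p)_k = (a;p)_k (1 - ax^2)/(1-a)$, from the same with $b$, and
  from \<open>qtop_shift\<close> for $z = c$.
\<close>

lemma series_term:
  fixes a b q :: complex
  defines "p \<equiv> q\<^sup>2" and "c \<equiv> a * b * q"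
  assumes ne: "q \<noteq> 0" "a \<noteq> 0" "b \<noteq> 0" and k: "k \<le> n"
    and nz: "qfac p p n \<noteq> 0" "qfac (c * p) p n \<noteq> 0" "qfac a p n \<noteq> 0" "qfac b p n \<noteq> 0"
    and nz1: "1 - a \<noteq> 0" "1 - b \<noteq> 0" "1 - c * p ^ n \<noteq> 0"
  shows "qfac (p powi (1 - int n) / p) p k * qfac (a * p) p k * qfac (b * p) p k
      * qfac (p powi (1 - int n) / c) p k * p ^ k
      / (qfac p p k * qfac (p powi (1 - int n) / a) p k * qfac (p powi (1 - int n) / b) p k
         * qfac (c * p) p k)
    = qfac p p n * qfac (c * p) p n
      / (qfac a p n * qfac b p n * (1 - c * p ^ n) * (1 - a) * (1 - b) * q ^ n)
      * (wcoeff a b q k * wcoeff a b q (n - k) * wt a b q (q ^ k) (q ^ (n - k)))"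
proof -
  define E where "E = (\<Prod>i<k. - (p powi (int i + 1 - int n)))"
  define x y where "x = q ^ k" and "y = q ^ (n - k)"
  have p: "p \<noteq> 0" and c: "c \<noteq> 0"
    using ne by (auto simp: p_def c_def)
  have E: "E \<noteq> 0"
    using p by (simp add: E_def)
  have rev: "qfac (p powi (1 - int n) / z) p k = E * qtop z p n k / z ^ k" if "z \<noteq> 0" for z
    using qfac_reverse[OF that p k] that by (simp add: E_def field_simps)
  have top: "qtop z p n k = qfac z p n / qfac z p (n - k)" and mono: "qfac z p k \<noteq> 0" "qfac z p (n - k) \<noteq> 0"
    if "qfac z p n \<noteq> 0" for z
    using qtop_mult[OF k, of z p] qfac_nonzero_mono[OF that, of k] qfac_nonzero_mono[OF that, of "n - k"] k
    by (auto simp: field_simps)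
  have pk: "p ^ k = x\<^sup>2" "p ^ (n - k) = y\<^sup>2"
    by (simp_all add: p_def x_def y_def mult.commute flip: power_mult)
  have topc: "qtop c p n k = (1 - c * y\<^sup>2) * (qfac (c * p) p n / qfac (c * p) p (n - k)) / (1 - c * p ^ n)"
    using qtop_shift[OF k, of c p] nz1(3)
    by (simp add: pk nonzero_eq_divide_eq flip: top[OF nz(2)])
  have shift: "qfac (z * p) p k = qfac z p k * (1 - z * x\<^sup>2) / (1 - z)" if "1 - z \<noteq> 0" for z
    using qfac_shift[of z p k] that by (simp add: pk field_simps)
  have xy: "q ^ n = x * y" and x: "x \<noteq> 0" and y: "y \<noteq> 0"
    using k ne by (simp_all add: x_def y_def flip: power_add)
  have ck: "c ^ k = a ^ k * b ^ k * x"
    by (simp add: c_def x_def power_mult_distrib)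
  have cp: "a * b * q ^ 3 = c * p"
    by (simp add: c_def p_def power2_eq_square power3_eq_cube)
  have "qfac (p powi (1 - int n) / p) p k * qfac (a * p) p k * qfac (b * p) p k
      * qfac (p powi (1 - int n) / c) p k * p ^ k
      / (qfac p p k * qfac (p powi (1 - int n) / a) p k * qfac (p powi (1 - int n) / b) p k
         * qfac (c * p) p k)
    = qtop p p n k * qfac (a * p) p k * qfac (b * p) p k * qtop c p n k
      / (x * qfac p p k * qtop a p n k * qtop b p n k * qfac (c * p) p k)"
    unfolding rev[OF p] rev[OF c] rev[OF ne(2)] rev[OF ne(3)] ck using E p ne
    by (simp add: divide_simps)
  also have "\<dots> = qfac p p n * qfac (c * p) p n
      / (qfac a p n * qfac b p n * (1 - c * p ^ n) * (1 - a) * (1 - b) * (x * y))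
      * (wcoeff a b q k * wcoeff a b q (n - k) * wt a b q x y)"
    unfolding topc top[OF nz(1)] top[OF nz(3)] top[OF nz(4)] shift[OF nz1(1)] shift[OF nz1(2)]
      wcoeff_def wt_def cp p_def[symmetric] c_def[symmetric]
    using nz nz1 x y mono[OF nz(1)] mono[OF nz(2)] mono[OF nz(3)] mono[OF nz(4)]
    by (simp add: divide_simps)
  finally show ?thesis
    by (simp add: xy flip: x_def y_def)
qed

theorem mainTheorem6:
  fixes n :: nat and q a b :: complex
  assumes "q \<noteq> 0" and "a \<noteq> 0" and "b \<noteq> 0"
    and "\<And>k. k \<le> n \<Longrightarrow>
      qpochs [q\<^sup>2, q powi (2 - 2 * int n) / a, q powi (2 - 2 * int n) / b, a * b * q ^ 3]
        (q\<^sup>2) (int k) \<noteq> 0"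
    and "1 - a * b * q ^ (2 * n + 1) \<noteq> 0"
    and "qpoch (a * b * q\<^sup>2) q (int n - 1) \<noteq> 0"
    and "qpochs [a, b] (q\<^sup>2) (int n) \<noteq> 0"
  shows "phi43 (q powi (- 2 * int n)) (a * q\<^sup>2) (b * q\<^sup>2) (q powi (1 - 2 * int n) / (a * b))
      (q powi (2 - 2 * int n) / a) (q powi (2 - 2 * int n) / b) (a * b * q ^ 3) (q\<^sup>2) (q\<^sup>2) =
    q powi (- int n) * qpochs [a * q, b * q, - q] q (int n) * qpoch (a * b * q\<^sup>2) (q\<^sup>2) (int n)
    / ((1 - a * b * q ^ (2 * n + 1)) * qpoch (a * b * q\<^sup>2) q (int n - 1)
       * qpochs [a, b] (q\<^sup>2) (int n))"
proof -
  define p where "p = q\<^sup>2"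
  define c where "c = a * b * q"
  have p: "p \<noteq> 0"
    using assms(1) by (simp add: p_def)
  have pi: "q powi (2 * j) = p powi j" for j
    by (simp add: p_def power_int_mult)
  have args: "q powi (- 2 * int n) = p powi (- int n)" "q powi (2 - 2 * int n) = p powi (1 - int n)"
      "a * b * q ^ 3 = c * p"
    using pi[of "- int n"] pi[of "1 - int n"]
    by (simp_all add: algebra_simps c_def p_def power2_eq_square power3_eq_cube)
  have x1: "p powi (- int n) = p powi (1 - int n) / p"
    using power_int_diff[OF disjI1[OF p], of "1 - int n" 1] by simp
  have x4: "q powi (1 - 2 * int n) / (a * b) = p powi (1 - int n) / c"
    using power_int_diff[OF disjI1[OF assms(1)], of "2 - 2 * int n" 1] args(2)
    by (simp add: c_def)
  have series: "phi43 (q powi (- 2 * int n)) (a * q\<^sup>2) (b * q\<^sup>2) (q powi (1 - 2 * int n) / (a * b))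
      (q powi (2 - 2 * int n) / a) (q powi (2 - 2 * int n) / b) (a * b * q ^ 3) (q\<^sup>2) (q\<^sup>2)
    = (\<Sum>k\<le>n. qfac (p powi (1 - int n) / p) p k * qfac (a * p) p k * qfac (b * p) p k
      * qfac (p powi (1 - int n) / c) p k * p ^ k
      / (qfac p p k * qfac (p powi (1 - int n) / a) p k * qfac (p powi (1 - int n) / b) p k
         * qfac (c * p) p k))"
    unfolding args x4 p_def[symmetric] phi43_terminating[OF p]
    by (simp add: qpochs_def qpoch_int x1 mult.assoc)
  show ?thesis
  proof (cases n)
    case 0
    \<comment> \<open>The index $-1$ contributes $1/(1 - abq)$, which cancels $1 - abq^{2n+1}$.\<close>
    have "qpoch (a * b * q\<^sup>2) q (- 1) = 1 / (1 - a * b * q)"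
      using assms(1) by (simp add: qpoch_def power2_eq_square)
    then show ?thesis
      unfolding series using 0 assms(5) by (simp add: qpochs_def qpoch_def)
  next
    case (Suc m)
    have nz: "qfac p p n \<noteq> 0" "qfac (c * p) p n \<noteq> 0" "qfac a p n \<noteq> 0" "qfac b p n \<noteq> 0"
      using assms(4)[of n] assms(7) by (auto simp: qpochs_def qpoch_int args simp flip: p_def)
    have nz1: "1 - a \<noteq> 0" "1 - b \<noteq> 0"
      using nz(3,4)[THEN qfac_nonzero_mono, of 1] Suc by (simp_all add: qfac_def)
    have cn: "a * b * q ^ (2 * n + 1) = c * p ^ n"
      by (simp add: c_def p_def power_mult)
    have nzq: "qfac (a * b * q\<^sup>2) q m \<noteq> 0"
      using assms(6) by (simp add: Suc qpoch_int)
    have split: "qfac p p n = qfac q q n * qfac (- q) q n"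
      unfolding p_def by (rule qfac_square)
    have V: "wsum a b q n * (qfac (c * p) p n * qfac (a * b * q\<^sup>2) q m * qfac q q n)
        = (1 - a) * (1 - b) * qfac (a * q) q n * qfac (b * q) q n * qfac (a * b * q\<^sup>2) p n"
      using wsum_closed[of q m a b] nz nzq unfolding Suc args p_def by blast
    define M where "M = qfac a p n * qfac b p n * (1 - c * p ^ n) * q ^ n"
    have "phi43 (q powi (- 2 * int n)) (a * q\<^sup>2) (b * q\<^sup>2) (q powi (1 - 2 * int n) / (a * b))
        (q powi (2 - 2 * int n) / a) (q powi (2 - 2 * int n) / b) (a * b * q ^ 3) (q\<^sup>2) (q\<^sup>2)
      = qfac p p n * qfac (c * p) p n
        / (qfac a p n * qfac b p n * (1 - c * p ^ n) * (1 - a) * (1 - b) * q ^ n) * wsum a b q n"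
      unfolding series wsum_def sum_distrib_left
      by (rule sum.cong[OF refl], unfold p_def c_def, rule series_term)
        (use assms(1-3,5) nz nz1 cn in \<open>simp_all add: p_def c_def mult.assoc\<close>)
    also have "\<dots> = qfac (- q) q n
        * (wsum a b q n * (qfac (c * p) p n * qfac (a * b * q\<^sup>2) q m * qfac q q n))
        / (M * (1 - a) * (1 - b) * qfac (a * b * q\<^sup>2) q m)"
      unfolding split M_def using nzq by (simp add: mult_ac)
    also have "\<dots> = qfac (- q) q n * qfac (a * q) q n * qfac (b * q) q n * qfac (a * b * q\<^sup>2) p n
        / (M * qfac (a * b * q\<^sup>2) q m)"
      unfolding V using nz1 by (simp add: mult_ac)
    also have "\<dots> = q powi (- int n) * qpochs [a * q, b * q, - q] q (int n) * qpoch (a * b * q\<^sup>2) (q\<^sup>2) (int n)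
      / ((1 - a * b * q ^ (2 * n + 1)) * qpoch (a * b * q\<^sup>2) q (int n - 1)
         * qpochs [a, b] (q\<^sup>2) (int n))"
    proof -
      have "qpoch (a * b * q\<^sup>2) q (int n - 1) = qfac (a * b * q\<^sup>2) q m"
        by (simp add: Suc qpoch_int)
      moreover have "q powi (- int n) = 1 / q ^ n"
        by (simp add: power_int_minus divide_inverse)
      ultimately show ?thesis
        unfolding cn M_def by (simp add: qpochs_def qpoch_int mult_ac flip: p_def)
    qed
    finally show ?thesis .
  qed
qed

end
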